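(* Let $\mathcal{E}$ be the monoid of strictly increasing maps $\omega\to\omega$ and let $g\in\mathcal{E}$ with $g\neq \mathrm{id}_{\omega}$. Then $(\mathcal{E},\rho_{g})\equiv_{\mathrm{ch}}([\omega]^{\omega},\mathsf{S})$; that is, there exists a continuous map $\varphi:\mathcal{E}\to[\omega]^{\omega}$ with $\varphi(f\circ g)=\mathsf{S}(\varphi(f))$ for all $f\in\mathcal{E}$, and there exists a continuous map $\psi:[\omega]^{\omega}\to\mathcal{E}$ with $\psi(\mathsf{S}(X))=\psi(X)\circ g$ for all $X\in[\omega]^{\omega}$.
   Context: $[\omega]^{\omega}$ denotes the set of infinite subsets of $\omega=\{0,1,2,\dots\}$, topologized as a subspace of the Cantor space $2^{\omega}$ (identifying sets with characteristic functions). The shift map $\mathsf{S}:[\omega]^{\omega}\to[\omega]^{\omega}$ is $\mathsf{S}(N)=N\setminus\{\min N\}$. $\mathcal{E}=\{f:\omega\to\omega\mid f \text{ injective and increasing}\}$ is a monoid under composition, with the topology induced by the Baire space $\omega^{\omega}$. For $g\in\mathcal{E}$, $\rho_{g}:\mathcal{E}\to\mathcal{E}$ is right composition $f\mapsto f\circ g$. A topological digraph is a topological space with a binary relation; for a function $h:A\to A$, $(A,h)$ denotes the digraph whose relation is the graph of $h$. $(A,R)\leq_{\mathrm{ch}}(B,T)$ means there is a continuous map $\varphi:A\to B$ with $a\,R\,a'\Rightarrow\varphi(a)\,T\,\varphi(a')$, and $\equiv_{\mathrm{ch}}$ means $\leq_{\mathrm{ch}}$ in both directions. *)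

theory Defs
  imports "HOL-Analysis.Function_Topology"
begin

definition baire_space :: "(nat \<Rightarrow> nat) topology" where
  "baire_space = product_topology (\<lambda>_. discrete_topology UNIV) UNIV"

definition cantor_space :: "(nat \<Rightarrow> bool) topology" where
  "cantor_space = product_topology (\<lambda>_. discrete_topology UNIV) UNIV"

(* The space of infinite subsets of omega: the topology pulled back from the Cantor
   space along the injection sending a set to its characteristic function. *)
definition infinite_subsets :: "nat set topology" where
  "infinite_subsets = pullback_topology {N. infinite N} (\<lambda>N n. n \<in> N) cantor_space"

definition shift :: "nat set \<Rightarrow> nat set" where
  "shift N = N - {LEAST n. n \<in> N}"

definition embeddings :: "(nat \<Rightarrow> nat) topology" where
  "embeddings = subtopology baire_space {f. strict_mono f}"

definition right_comp :: "(nat \<Rightarrow> nat) \<Rightarrow> (nat \<Rightarrow> nat) \<Rightarrow> (nat \<Rightarrow> nat)" where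
  "right_comp g f = f \<circ> g"

(* A topological digraph is a topological space together with a binary relation on its
   points; in the definitions below only the restriction of the relation to the points
   of the space matters. *)
type_synonym 'a topological_digraph = "'a topology \<times> 'a rel"

(* The digraph (A, h) of a self-map h of the space A. *)
definition fun_digraph :: "'a topology \<Rightarrow> ('a \<Rightarrow> 'a) \<Rightarrow> 'a topological_digraph" where
  "fun_digraph A h = (A, {(a, h a) | a. a \<in> topspace A})"

definition ch_le :: "'a topological_digraph \<Rightarrow> 'b topological_digraph \<Rightarrow> bool"
    (infix "\<le>\<^sub>c\<^sub>h" 50) where
  "G \<le>\<^sub>c\<^sub>h H \<longleftrightarrow>
     (\<exists>\<phi>. continuous_map (fst G) (fst H) \<phi> \<and>
          (\<forall>a\<in>topspace (fst G). \<forall>a'\<in>topspace (fst G).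
             (a, a') \<in> snd G \<longrightarrow> (\<phi> a, \<phi> a') \<in> snd H))"

definition ch_equiv :: "'a topological_digraph \<Rightarrow> 'b topological_digraph \<Rightarrow> bool"
    (infix "\<equiv>\<^sub>c\<^sub>h" 50) where
  "G \<equiv>\<^sub>c\<^sub>h H \<longleftrightarrow> G \<le>\<^sub>c\<^sub>h H \<and> H \<le>\<^sub>c\<^sub>h G"

lemma topspace_infinite_subsets [simp]: "topspace infinite_subsets = {N. infinite N}"
  by (auto simp: infinite_subsets_def topspace_pullback_topology cantor_space_def)

lemma topspace_embeddings [simp]: "topspace embeddings = {f. strict_mono f}"
  by (auto simp: embeddings_def baire_space_def)

lemma shift_in_infinite_subsets:
  "N \<in> topspace infinite_subsets \<Longrightarrow> shift N \<in> topspace infinite_subsets"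
  by (simp add: shift_def)

lemma right_comp_in_embeddings:
  "strict_mono g \<Longrightarrow> f \<in> topspace embeddings \<Longrightarrow> right_comp g f \<in> topspace embeddings"
  by (simp add: right_comp_def strict_mono_def)

end

theory Submission
  imports Defs "HOL-Library.Infinite_Set"
begin

(* Let k be the least point moved by g. The orbit of k under g is infinite, and
   f |-> f ` orbit turns right composition with g into removal of the minimum.
   Conversely, the orbit cuts [k, \<omega>) into the intervals I_l = [g^l(k), g^(l+1)(k)),
   and g maps I_l into I_(l+1). If x_0 < x_1 < ... enumerates X, then letting \<psi>(X) act
   on I_l as the embedding g^(x_l - l) of I_l into I_(x_l), and as the identity below k,
   gives a strictly increasing map with \<psi>(X) \<circ> g = \<psi>(S X). *)

section \<open>Continuity from dependence on finitely many values\<close>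

lemma continuous_map_finitely_determined:
  fixes S :: "(nat \<Rightarrow> 'a) set"
  assumes "\<And>x. x \<in> S \<Longrightarrow> \<exists>n. \<forall>y\<in>S. (\<forall>i<n. x i = y i) \<longrightarrow> F x = F y"
  shows "continuous_map (subtopology (product_topology (\<lambda>_. discrete_topology UNIV) UNIV) S)
           (discrete_topology UNIV) F"
proof -
  let ?P = "product_topology (\<lambda>_::nat. discrete_topology (UNIV :: 'a set)) UNIV"
  have "openin (subtopology ?P S) {x \<in> S. F x \<in> U}" for U
  proof (subst openin_subopen, intro ballI)
    fix x assume "x \<in> {x \<in> S. F x \<in> U}"
    then have x: "x \<in> S" "F x \<in> U" by simp_all
    from assms[OF x(1)] obtain n where n: "\<forall>y\<in>S. (\<forall>i<n. x i = y i) \<longrightarrow> F x = F y" ..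
    \<comment> \<open>The cylinder of sequences agreeing with \<open>x\<close> below
      \<open>n\<close>: it restricts only finitely many coordinates, hence is open, and
      \<open>F\<close> is constant on its trace in \<open>S\<close>.\<close>
    let ?V = "\<Pi>\<^sub>E i\<in>UNIV. if i < n then {x i} else UNIV"
    have "finite {i. (if i < n then {x i} else UNIV) \<noteq> UNIV}"
      by (rule finite_subset[of _ "{..<n}"]) (auto split: if_splits)
    then have "openin ?P ?V"
      by (intro product_topology_basis) auto
    then have "openin (subtopology ?P S) (?V \<inter> S)"
      by (auto simp: openin_subtopology)
    moreover have "?V \<inter> S \<subseteq> {x \<in> S. F x \<in> U}"
    proof
      fix y assume y: "y \<in> ?V \<inter> S"
      have "x i = y i" if "i < n" for i
      proof -
        have "y i \<in> (if i < n then {x i} else UNIV)"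
          using y by (intro PiE_mem[of y UNIV]) simp_all
        with that show ?thesis by simp
      qed
      moreover have "y \<in> S" using y by simp
      ultimately have "F x = F y" using n by simp
      with x(2) \<open>y \<in> S\<close> show "y \<in> {x \<in> S. F x \<in> U}" by simp
    qed
    moreover have "x \<in> ?V \<inter> S"
      using x(1) by (simp add: PiE_iff)
    ultimately show "\<exists>T. openin (subtopology ?P S) T \<and> x \<in> T \<and> T \<subseteq> {x \<in> S. F x \<in> U}"
      by blast
  qed
  then show ?thesis
    by (simp add: continuous_map_def)
qed

text \<open>By the pullback topology, it suffices to treat the characteristic function of
  \<open>\<phi> f\<close> coordinate by coordinate, each coordinate being a discrete-valued
  map.\<close>

lemma continuous_map_embeddings_infinite_subsets:
  assumes "\<And>f. strict_mono f \<Longrightarrow> infinite (\<phi> f)"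
    and "\<And>f m. strict_mono f \<Longrightarrow>
           \<exists>n. \<forall>h. strict_mono h \<longrightarrow> (\<forall>i<n. f i = h i) \<longrightarrow> (m \<in> \<phi> f \<longleftrightarrow> m \<in> \<phi> h)"
  shows "continuous_map embeddings infinite_subsets \<phi>"
proof -
  have "continuous_map embeddings (discrete_topology UNIV) (\<lambda>f. m \<in> \<phi> f)" for m
    unfolding embeddings_def baire_space_def
    by (rule continuous_map_finitely_determined) (use assms(2) in simp)
  then have "continuous_map embeddings cantor_space ((\<lambda>N n. n \<in> N) \<circ> \<phi>)"
    by (simp add: cantor_space_def continuous_map_componentwise_UNIV)
  then show ?thesis
    unfolding infinite_subsets_def
    by (rule continuous_map_pullback') (use assms(1) in auto)
qed

lemma continuous_map_infinite_subsets_embeddings: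
  assumes "\<And>X. infinite X \<Longrightarrow> strict_mono (\<psi> X)"
    and "\<And>X m. infinite X \<Longrightarrow>
           \<exists>n. \<forall>Y. infinite Y \<longrightarrow> (\<forall>i<n. i \<in> X \<longleftrightarrow> i \<in> Y) \<longrightarrow> \<psi> X m = \<psi> Y m"
  shows "continuous_map infinite_subsets embeddings \<psi>"
proof -
  let ?I = "{p. infinite {n. p n}}"
  have "continuous_map infinite_subsets (subtopology cantor_space ?I) (\<lambda>N n. n \<in> N)"
  proof (rule continuous_map_into_subtopology)
    have "continuous_map infinite_subsets cantor_space (id \<circ> (\<lambda>N n. n \<in> N))"
      unfolding infinite_subsets_def by (rule continuous_map_pullback) simp
    then show "continuous_map infinite_subsets cantor_space (\<lambda>N n. n \<in> N)"
      by (simp add: o_def)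
  qed auto
  \<comment> \<open>The criterion speaks of sequences, so \<open>\<psi>\<close> is factored through
    characteristic functions; \<open>{n. p n}\<close> recovers the set from
    \<open>p\<close>.\<close>
  moreover have "continuous_map (subtopology cantor_space ?I) (discrete_topology UNIV)
      (\<lambda>p. \<psi> {n. p n} m)" for m
    unfolding cantor_space_def
  proof (rule continuous_map_finitely_determined)
    fix p :: "nat \<Rightarrow> bool" assume "p \<in> ?I"
    with assms(2)[of "{n. p n}" m] obtain n
      where "\<And>Y. infinite Y \<Longrightarrow> \<forall>i<n. p i \<longleftrightarrow> i \<in> Y \<Longrightarrow> \<psi> {n. p n} m = \<psi> Y m"
      by auto
    from this[of "{n. q n}" for q]
    show "\<exists>n. \<forall>q\<in>?I. (\<forall>i<n. p i = q i) \<longrightarrow> \<psi> {n. p n} m = \<psi> {n. q n} m"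
      by (intro exI[of _ n]) simp
  qed
  ultimately have "continuous_map infinite_subsets (discrete_topology UNIV)
      ((\<lambda>p. \<psi> {n. p n} m) \<circ> (\<lambda>N n. n \<in> N))" for m
    by (rule continuous_map_compose)
  then have "continuous_map infinite_subsets baire_space \<psi>"
    by (simp add: baire_space_def continuous_map_componentwise_UNIV o_def)
  then show ?thesis
    unfolding embeddings_def
    by (rule continuous_map_into_subtopology) (use assms(1) in auto)
qed

lemma ch_le_fun_digraphI:
  assumes "continuous_map A B \<phi>" and "\<And>a. a \<in> topspace A \<Longrightarrow> \<phi> (h a) = k (\<phi> a)"
  shows "fun_digraph A h \<le>\<^sub>c\<^sub>h fun_digraph B k"
  unfolding ch_le_def fun_digraph_def
  using assms continuous_map_image_subset_topspace[OF assms(1)]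
  by (intro exI[of _ \<phi>]) auto

section \<open>Enumerations of infinite sets under the shift and under finite agreement\<close>

lemma enumerate_Suc_shift: "enumerate X (Suc l) = enumerate (shift X) l"
  by (simp add: shift_def enumerate_Suc)

lemma Least_cong_initial:
  fixes X Y :: "'a :: wellorder set"
  assumes "X \<noteq> {}" and "\<And>i. i \<le> (LEAST i. i \<in> X) \<Longrightarrow> i \<in> X \<longleftrightarrow> i \<in> Y"
  shows "(LEAST i. i \<in> Y) = (LEAST i. i \<in> X)"
proof (rule Least_equality)
  have "(LEAST i. i \<in> X) \<in> X" using assms(1) by (auto intro: LeastI)
  with assms(2) show "(LEAST i. i \<in> X) \<in> Y" by blast
next
  fix i assume "i \<in> Y"
  show "(LEAST i. i \<in> X) \<le> i"
  proof (rule ccontr)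
    assume "\<not> (LEAST i. i \<in> X) \<le> i"
    then have less: "i < (LEAST i. i \<in> X)" by simp
    with \<open>i \<in> Y\<close> assms(2)[of i] have "i \<in> X" by simp
    with not_less_Least[OF less] show False by simp
  qed
qed

text \<open>Supplies the finite dependence behind the continuity of \<open>spread\<close>. The
  induction generalizes over both sets because its step passes to their shifts.\<close>

lemma enumerate_cong_initial:
  fixes X Y :: "nat set"
  assumes "infinite X" "infinite Y" "\<And>i. i \<le> enumerate X l \<Longrightarrow> i \<in> X \<longleftrightarrow> i \<in> Y"
  shows "enumerate X l = enumerate Y l"
  using assms
proof (induction l arbitrary: X Y)
  case 0
  have "(LEAST i. i \<in> Y) = (LEAST i. i \<in> X)"
  proof (rule Least_cong_initial)
    show "X \<noteq> {}" using 0(1) by auto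
    show "i \<in> X \<longleftrightarrow> i \<in> Y" if "i \<le> (LEAST i. i \<in> X)" for i
      using that 0(3)[of i] by (simp only: enumerate_0)
  qed
  then show ?case by (simp only: enumerate_0)
next
  case (Suc l)
  \<comment> \<open>The range of agreement thus includes the minimum of \<open>X\<close>, so both
    sets lose the same point under \<open>shift\<close>.\<close>
  have "(LEAST i. i \<in> X) \<le> enumerate X (Suc l)"
    using enumerate_mono[of 0 "Suc l" X] Suc.prems(1) by (simp only: enumerate_0) simp
  then have "(LEAST i. i \<in> Y) = (LEAST i. i \<in> X)"
    using Suc.prems(1) by (intro Least_cong_initial Suc.prems(3)) auto
  then have "i \<in> shift X \<longleftrightarrow> i \<in> shift Y" if "i \<le> enumerate (shift X) l" for i
    using Suc.prems(3)[of i] that by (simp add: shift_def enumerate_Suc)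
  moreover have "infinite (shift X)" "infinite (shift Y)"
    using Suc.prems(1,2) by (simp_all add: shift_def)
  ultimately show ?case
    unfolding enumerate_Suc_shift by (intro Suc.IH)
qed

lemma strict_mono_funpow:
  fixes g :: "'a :: order \<Rightarrow> 'a"
  assumes "strict_mono g"
  shows "strict_mono (g ^^ n)"
  by (induction n) (use assms in \<open>auto simp: strict_mono_def\<close>)

section \<open>The least moved point, its orbit, and the two equivariant maps\<close>

locale least_moved =
  fixes g :: "nat \<Rightarrow> nat" and k :: nat
  assumes mono_g: "strict_mono g" and moved: "k < g k" and fixed: "\<And>n. n < k \<Longrightarrow> g n = n"
begin

lemma orbit_mono: "strict_mono (\<lambda>n. (g ^^ n) k)"
proof (rule strict_mono_Suc_iff[THEN iffD2], rule allI)
  show "(g ^^ n) k < (g ^^ Suc n) k" for n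
    using strict_monoD[OF strict_mono_funpow[OF mono_g] moved, of n]
    by (simp add: funpow_swap1)
qed

definition orbit_image :: "(nat \<Rightarrow> nat) \<Rightarrow> nat set" where
  "orbit_image f = range (\<lambda>n. f ((g ^^ n) k))"

lemma orbit_image_mono: "strict_mono f \<Longrightarrow> strict_mono (\<lambda>n. f ((g ^^ n) k))"
  using orbit_mono by (simp add: strict_mono_def)

text \<open>Precomposing with \<open>g\<close> advances the orbit by one step, so exactly the value
  at \<open>k\<close> is lost, and it is the least because the values increase along the
  orbit.\<close>

lemma orbit_image_comp:
  assumes "strict_mono f"
  shows "orbit_image (f \<circ> g) = shift (orbit_image f)"
proof -
  let ?a = "\<lambda>n. f ((g ^^ n) k)"
  have a: "strict_mono ?a" by (rule orbit_image_mono[OF assms])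
  have "(LEAST m. m \<in> range ?a) = ?a 0"
    by (rule Least_equality) (use strict_mono_less_eq[OF a] in blast)+
  moreover have "range ?a - {?a 0} = ?a ` (UNIV - {0})"
    using strict_mono_imp_inj_on[OF a] by (subst image_set_diff) auto
  moreover have "UNIV - {0} = range Suc"
    by (auto simp: image_iff) (metis not0_implies_Suc)
  ultimately show ?thesis
    by (simp add: orbit_image_def shift_def image_image)
qed

lemma continuous_map_orbit_image: "continuous_map embeddings infinite_subsets orbit_image"
proof (rule continuous_map_embeddings_infinite_subsets)
  fix f :: "nat \<Rightarrow> nat" assume f: "strict_mono f"
  then show "infinite (orbit_image f)"
    unfolding orbit_image_def
    by (intro range_inj_infinite strict_mono_imp_inj_on orbit_image_mono)
  fix m
  \<comment> \<open>The value at orbit index \<open>n\<close> is at least \<open>n\<close>, so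
    \<open>m\<close> can only be attained at an index up to \<open>m\<close>; hence the values of
    \<open>h\<close> up to \<open>(g ^^ m) k\<close> decide membership.\<close>
  have "m \<in> orbit_image h \<longleftrightarrow> (\<exists>n\<le>m. m = h ((g ^^ n) k))" if "strict_mono h" for h
    using strict_mono_imp_increasing[OF orbit_image_mono[OF that]]
    by (auto simp: orbit_image_def)
  moreover have "(g ^^ n) k < Suc ((g ^^ m) k)" if "n \<le> m" for n
    using strict_mono_less_eq[OF orbit_mono] that by (simp add: less_Suc_eq_le)
  ultimately show "\<exists>n. \<forall>h. strict_mono h \<longrightarrow> (\<forall>i<n. f i = h i) \<longrightarrow>
      (m \<in> orbit_image f \<longleftrightarrow> m \<in> orbit_image h)"
    using f by (intro exI[of _ "Suc ((g ^^ m) k)"]) auto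
qed

(* level n is the l with n in I_l; every n < k also gets level 0. *)
definition level :: "nat \<Rightarrow> nat" where
  "level n = (LEAST l. n < (g ^^ Suc l) k)"

lemma less_orbit_level: "n < (g ^^ Suc (level n)) k"
  unfolding level_def
  \<comment> \<open>The index \<open>n\<close> is a witness because the orbit point of index
    \<open>Suc n\<close> is at least \<open>Suc n\<close>.\<close>
  by (rule LeastI[of _ n])
    (metis Suc_le_lessD orbit_mono strict_mono_imp_increasing)

text \<open>Follows from minimality of the level. The index 0 is excluded because points below
  \<open>k\<close> also have level 0.\<close>

lemma orbit_le_iff_level:
  assumes "0 < l"
  shows "(g ^^ l) k \<le> n \<longleftrightarrow> l \<le> level n"
proof
  assume "(g ^^ l) k \<le> n"
  then have "(g ^^ l) k < (g ^^ Suc (level n)) k"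
    using less_orbit_level by (rule le_less_trans)
  then show "l \<le> level n"
    using strict_mono_less[OF orbit_mono, of l "Suc (level n)"] by (simp only: less_Suc_eq_le)
next
  assume "l \<le> level n"
  with assms have "\<not> n < (g ^^ Suc (l - 1)) k"
    unfolding level_def by (intro not_less_Least) simp
  with assms show "(g ^^ l) k \<le> n" by simp
qed

lemma level_mono: "n \<le> m \<Longrightarrow> level n \<le> level m"
  by (metis orbit_le_iff_level le_trans order_refl gr0I zero_le)

lemma level_below: "n < k \<Longrightarrow> level n = 0"
  using moved by (simp add: level_def)

text \<open>Applying \<open>g\<close> to both ends of the interval containing \<open>n\<close> gives
  the next interval.\<close>

lemma level_step:
  assumes "k \<le> n"
  shows "level (g n) = Suc (level n)"
proof (rule antisym)
  have "g n < (g ^^ Suc (Suc (level n))) k"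
    using strict_monoD[OF mono_g less_orbit_level[of n]] by simp
  then show "level (g n) \<le> Suc (level n)"
    unfolding level_def[of "g n"] by (rule Least_le)
  \<comment> \<open>At level 0 this is the assumption \<open>k \<le> n\<close>; at positive levels
    it comes from \<open>orbit_le_iff_level\<close>.\<close>
  have "(g ^^ level n) k \<le> n"
    using assms orbit_le_iff_level[of "level n" n] by (cases "level n = 0") auto
  then have "(g ^^ Suc (level n)) k \<le> g n"
    using strict_mono_less_eq[OF mono_g] by simp
  then show "Suc (level n) \<le> level (g n)"
    using orbit_le_iff_level by blast
qed

lemma funpow_below: "n < k \<Longrightarrow> (g ^^ i) n = n"
  by (induction i) (auto simp: fixed)

text \<open>The subtraction is exact for infinite \<open>X\<close>, whose element of index
  \<open>l\<close> is at least \<open>l\<close>. Powers of \<open>g\<close> fix the points below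
  \<open>k\<close>, so the same formula is the identity there.\<close>

definition spread :: "nat set \<Rightarrow> nat \<Rightarrow> nat" where
  "spread X n = (g ^^ (enumerate X (level n) - level n)) n"

lemma spread_shift:
  assumes "infinite X"
  shows "spread (shift X) = spread X \<circ> g"
proof
  fix n
  show "spread (shift X) n = (spread X \<circ> g) n"
  proof (cases "n < k")
    case True
    then show ?thesis by (simp add: spread_def funpow_below fixed)
  next
    case False
    have "infinite (shift X)" using assms by (simp add: shift_def)
    then have "level n \<le> enumerate (shift X) (level n)"
      by (rule le_enumerate)
    moreover have "Suc (level n) \<le> enumerate X (Suc (level n))"
      using assms by (rule le_enumerate)
    \<comment> \<open>Both shifting \<open>X\<close> and applying \<open>g\<close> raise the index
      into \<open>X\<close> by one; the extra power on the left is the \<open>g\<close> applied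
      first in \<open>spread X \<circ> g\<close>.\<close>
    ultimately have "enumerate (shift X) (level n) - level n
        = Suc (enumerate X (Suc (level n)) - Suc (level n))"
      by (simp add: enumerate_Suc_shift)
    with False show ?thesis
      by (simp add: spread_def level_step funpow_swap1)
  qed
qed

text \<open>Neighbours of equal level are moved by the same power of \<open>g\<close>. Where the
  level rises, orbit points separate the images, since \<open>X\<close> is enumerated
  increasingly.\<close>

lemma spread_strict_mono:
  assumes "infinite X"
  shows "strict_mono (spread X)"
proof (rule strict_mono_Suc_iff[THEN iffD2], rule allI)
  fix n
  let ?l = "level n" and ?m = "level (Suc n)" and ?x = "enumerate X"
  note pow_mono = strict_mono_funpow[OF mono_g]
  show "spread X n < spread X (Suc n)"
  proof (cases "?l = ?m")
    case True
    then show ?thesis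
      using strict_monoD[OF pow_mono, of n "Suc n"] by (simp add: spread_def)
  next
    case False
    then have lm: "?l < ?m" using level_mono[of n "Suc n"] by simp
    have xl: "?l \<le> ?x ?l" and xm: "?m \<le> ?x ?m"
      using assms by (auto intro: le_enumerate)
    have "spread X n < (g ^^ (?x ?l - ?l)) ((g ^^ Suc ?l) k)"
      unfolding spread_def by (rule strict_monoD[OF pow_mono less_orbit_level])
    also have "\<dots> = (g ^^ Suc (?x ?l)) k"
      using xl by (metis add_Suc_right comp_apply funpow_add le_add_diff_inverse2)
    also have "\<dots> \<le> (g ^^ ?x ?m) k"
      using strict_mono_less_eq[OF orbit_mono, of "Suc (?x ?l)" "?x ?m"]
        enumerate_mono[OF lm assms]
      by (simp only: Suc_le_eq)
    also have "\<dots> = (g ^^ (?x ?m - ?m)) ((g ^^ ?m) k)"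
      using xm by (metis comp_apply funpow_add le_add_diff_inverse2)
    \<comment> \<open>Here \<open>?m\<close> is positive, being above \<open>?l\<close>, so
      \<open>Suc n\<close> is at least the orbit point of index \<open>?m\<close>.\<close>
    also have "\<dots> \<le> spread X (Suc n)"
      unfolding spread_def using lm orbit_le_iff_level[of ?m "Suc n"]
      by (simp add: strict_mono_less_eq[OF pow_mono])
    finally show ?thesis .
  qed
qed

lemma continuous_map_spread: "continuous_map infinite_subsets embeddings spread"
proof (rule continuous_map_infinite_subsets_embeddings)
  fix X :: "nat set" and m assume X: "infinite X"
  \<comment> \<open>\<open>spread X m\<close> depends on \<open>X\<close> only through this one
    element; the \<open>Suc\<close> makes the agreement include the element itself.\<close>
  then have "enumerate X (level m) = enumerate Y (level m)"
    if "infinite Y" "\<forall>i<Suc (enumerate X (level m)). i \<in> X \<longleftrightarrow> i \<in> Y" for Y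
    using that by (intro enumerate_cong_initial) auto
  then show "\<exists>n. \<forall>Y. infinite Y \<longrightarrow> (\<forall>i<n. i \<in> X \<longleftrightarrow> i \<in> Y) \<longrightarrow> spread X m = spread Y m"
    unfolding spread_def by metis
qed (rule spread_strict_mono)

end

section \<open>Assembly of the two reductions\<close>

theorem theorem4p8:
  fixes g :: "nat \<Rightarrow> nat"
  assumes "strict_mono g" and "g \<noteq> id"
  shows "fun_digraph embeddings (right_comp g) \<equiv>\<^sub>c\<^sub>h fun_digraph infinite_subsets shift \<and>
    (\<exists>\<phi>. continuous_map embeddings infinite_subsets \<phi> \<and>
         (\<forall>f. strict_mono f \<longrightarrow> \<phi> (f \<circ> g) = shift (\<phi> f))) \<and>
    (\<exists>\<psi>. continuous_map infinite_subsets embeddings \<psi> \<and>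
         (\<forall>X. infinite X \<longrightarrow> \<psi> (shift X) = \<psi> X \<circ> g))"
proof -
  define k where "k = (LEAST n. g n \<noteq> n)"
  have "\<exists>n. g n \<noteq> n" using assms(2) by auto
  then have "g k \<noteq> k" unfolding k_def by (rule LeastI_ex)
  moreover have "g n = n" if "n < k" for n
    using not_less_Least that unfolding k_def by blast
  \<comment> \<open>A strictly increasing map on the naturals never lowers a point, so the moved
    point \<open>k\<close> satisfies \<open>k < g k\<close>.\<close>
  ultimately interpret least_moved g k
    using assms(1) strict_mono_imp_increasing[OF assms(1), of k]
    by unfold_locales auto
  have "fun_digraph embeddings (right_comp g) \<equiv>\<^sub>c\<^sub>h fun_digraph infinite_subsets shift"
    unfolding ch_equiv_def
  proof
    show "fun_digraph embeddings (right_comp g) \<le>\<^sub>c\<^sub>h fun_digraph infinite_subsets shift"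
      by (rule ch_le_fun_digraphI[OF continuous_map_orbit_image])
        (simp add: right_comp_def orbit_image_comp)
    show "fun_digraph infinite_subsets shift \<le>\<^sub>c\<^sub>h fun_digraph embeddings (right_comp g)"
      by (rule ch_le_fun_digraphI[OF continuous_map_spread])
        (simp add: right_comp_def spread_shift)
  qed
  then show ?thesis
    using continuous_map_orbit_image orbit_image_comp continuous_map_spread spread_shift
    by blast
qed

end
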